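(* Let $\mathcal{F}_{J_0}^J(\eta,\mathcal{Q})=\{\varphi_{J_0,k}:1\le k\le N_{J_0}\}\cup\{\psi_{j,k}^{(s)}:1\le k\le N_{j+1},\ 1\le s\le n\}_{j=J_0}^{J}$ be the truncated spherical framelet system determined by the filter bank $\eta=\{a;b_1,\ldots,b_n\}\subset l_1(\mathbb{Z})$ and the quadrature rules $\mathcal{Q}$ (see context), where $\eta$ satisfies the partition of unity condition $$|\hat a(\xi)|^2+\sum_{s=1}^n|\hat b_s(\xi)|^2=1,\qquad\xi\in\mathbb{R},$$ with $\mathrm{supp}\,\hat a\subseteq[0,\frac14]$ and $\mathrm{supp}\,\hat b_s\subseteq[0,\frac12]$ for $s=1,\ldots,n$. Let $f\in\Pi_{t_J}$, let $\mathsf{v}_{j,k}=\langle f,\varphi_{j,k}\rangle$ and $\mathsf{w}_{j,k}^{(s)}=\langle f,\psi_{j,k}^{(s)}\rangle$, and define $$\bm{v}_j=(\mathsf{v}_{j,k})_{k=1}^{N_j}\in\mathbb{C}^{N_j}\ (j=J_0,\ldots,J+1),\qquad \bm{w}_j^{(s)}=(\mathsf{w}_{j,k}^{(s)})_{k=1}^{N_{j+1}}\in\mathbb{C}^{N_{j+1}}\ (j=J_0,\ldots,J),$$ $$\hat{\bm{a}}_j=\Big(\hat a\Big(\frac{\lambda_{\ell,m}}{t_{j+1}}\Big)\Big)_{(\ell,m)\in\mathcal{I}_{t_{j+1}}},\qquad \hat{\bm{b}}_j^{(s)}=\Big(\hat b_s\Big(\frac{\lambda_{\ell,m}}{t_{j+1}}\Big)\Big)_{(\ell,m)\in\mathcal{I}_{t_{j+1}}}\qquad(j=J_0,\ldots,J).$$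 Let $w_j=\frac{4\pi}{N_j}$. Then, for $j=J_0,\ldots,J$, we have the one-level framelet decomposition that obtains $\{\bm{v}_j,\bm{w}_j^{(s)}:s=1,\ldots,n\}$ from $\bm{v}_{j+1}$: $$\bm{v}_j=\sqrt{w_j}\,\bm{Y}_{t_j}\Big[\big[(\sqrt{w_{j+1}}\,\bm{Y}_{t_{j+1}}^\star\bm{v}_{j+1})\odot\overline{\hat{\bm{a}}_j}\big]\downarrow_j\Big],$$ $$\bm{w}_j^{(s)}=\sqrt{w_{j+1}}\,\bm{Y}_{t_{j+1}}\Big[(\sqrt{w_{j+1}}\,\bm{Y}_{t_{j+1}}^\star\bm{v}_{j+1})\odot\overline{\hat{\bm{b}}_j^{(s)}}\Big],\qquad s=1,\ldots,n,$$ and the one-level framelet reconstruction of $\bm{v}_{j+1}$ from $\{\bm{v}_j,\bm{w}_j^{(s)}:s=1,\ldots,n\}$: $$\bm{v}_{j+1}=\sqrt{w_{j+1}}\,\bm{Y}_{t_{j+1}}\Big[\big[\sqrt{w_j}\,\bm{Y}_{t_j}^\star\bm{v}_j\big]\uparrow_{j+1}\odot\,\hat{\bm{a}}_j+\sum_{s=1}^n\big[(\sqrt{w_{j+1}}\,\bm{Y}_{t_{j+1}}^\star\bm{w}_j^{(s)})\odot\hat{\bm{b}}_j^{(s)}\big]\Big].$$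
   Context: $Y_\ell^m$ ($\ell\in\mathbb{N}_0$, $|m|\le\ell$) are the standard complex spherical harmonics, an orthonormal basis of $L^2(\mathbb{S}^2)$ (surface measure $\mu_2$, total mass $4\pi$), with $\langle f_1,f_2\rangle=\int_{\mathbb{S}^2}f_1\overline{f_2}\,d\mu_2$. $\mathcal{I}_t=\{(\ell,m):0\le\ell\le t,\ -\ell\le m\le\ell\}$ and $\Pi_t=\mathrm{span}\{Y_\ell^m:(\ell,m)\in\mathcal{I}_t\}$, the polynomials of degree at most $t$ restricted to $\mathbb{S}^2$. A point set $\{\bm{x}_1,\ldots,\bm{x}_N\}\subset\mathbb{S}^2$ is a spherical $t$-design if $\frac1N\sum_{i=1}^Np(\bm{x}_i)=\frac1{4\pi}\int_{\mathbb{S}^2}p\,d\mu_2$ for all $p\in\Pi_t$. Scales: $J_0\le J$ are integers. Quadrature rules: $\mathcal{Q}=\{Q_{N_j,t_j}:j=J_0,\ldots,J+1\}$, where $t_j$ are positive integers with $t_{j+1}=2t_j$, $X_{N_j}=\{\bm{x}_{j,1},\ldots,\bm{x}_{j,N_j}\}\subset\mathbb{S}^2$ is a spherical $t_j$-design, and $Q_{N_j,t_j}=\{(\bm{x}_{j,k},w_{j,k})\}_{k=1}^{N_j}$ with $w_{j,k}\equiv\frac{4\pi}{N_j}$. Filter bank: $l_1(\mathbb{Z})=\{h=\{h_k\}_{k\in\mathbb{Z}}\subset\mathbb{C}:\sum_{k\in\mathbb{Z}}|h_k|<\infty\}$, and for a filter $h=\{h_k\}_{k\in\mathbb{Z}}$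 its Fourier series is $\hat h(\xi)=\sum_{k\in\mathbb{Z}}h_ke^{-2\pi\mathrm{i}k\xi}$, $\xi\in\mathbb{R}$. With $\lambda_{\ell,m}=\ell$, set $\hat\alpha^{(J+1)}(\frac{\lambda_{\ell,m}}{t_{J+1}})=1$ for $\ell\le t_J$ and $=0$ for $\ell>t_J$, and recursively for $j$ decreasing from $J$ to $J_0$, $$\hat\alpha^{(j)}\Big(\frac{\lambda_{\ell,m}}{t_j}\Big)=\hat a\Big(\frac{\lambda_{\ell,m}}{t_{j+1}}\Big)\hat\alpha^{(j+1)}\Big(\frac{\lambda_{\ell,m}}{t_{j+1}}\Big),\qquad \hat\beta_s^{(j)}\Big(\frac{\lambda_{\ell,m}}{t_j}\Big)=\hat b_s\Big(\frac{\lambda_{\ell,m}}{t_{j+1}}\Big)\hat\alpha^{(j+1)}\Big(\frac{\lambda_{\ell,m}}{t_{j+1}}\Big),\quad s=1,\ldots,n.$$ The framelets are $$\varphi_{j,k}(\bm{x})=\sqrt{w_{j,k}}\sum_{(\ell,m)\in\mathcal{I}_{t_j}}\hat\alpha^{(j)}\Big(\frac{\lambda_{\ell,m}}{t_j}\Big)\overline{Y_\ell^m(\bm{x}_{j,k})}Y_\ell^m(\bm{x}),$$ $$\psi_{j,k}^{(s)}(\bm{x})=\sqrt{w_{j+1,k}}\sum_{(\ell,m)\in\mathcal{I}_{t_{j+1}}}\hat\beta_s^{(j)}\Big(\frac{\lambda_{\ell,m}}{t_j}\Big)\overline{Y_\ell^m(\bm{x}_{j+1,k})}Y_\ell^m(\bm{x}),$$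 with $j=J_0,\ldots,J+1$ for $\varphi_{j,k}$ and $j=J_0,\ldots,J$ for $\psi_{j,k}^{(s)}$. Matrices and operators: $\bm{Y}_{t_j}=\bm{Y}_{t_j}(X_{N_j})=(Y_\ell^m(\bm{x}_{j,k}))_{k=1,\ldots,N_j;\,(\ell,m)\in\mathcal{I}_{t_j}}\in\mathbb{C}^{N_j\times(t_j+1)^2}$, and $\bm{Y}_{t_j}^\star$ is its conjugate transpose. For $\hat{\bm{c}}=(\hat c_\ell^m)_{(\ell,m)\in\mathcal{I}_{t_{j+1}}}$, the downsampling is $\hat{\bm{c}}\downarrow_j=(\hat c_\ell^m)_{(\ell,m)\in\mathcal{I}_{t_j}}$. For $\hat{\bm{c}}=(\hat c_\ell^m)_{(\ell,m)\in\mathcal{I}_{t_j}}$, the upsampling is $\hat{\bm{c}}\uparrow_{j+1}=(\hat c_\ell^m)_{(\ell,m)\in\mathcal{I}_{t_{j+1}}}$ with $\hat c_\ell^m=0$ for $\ell>t_j$. $\odot$ is the entrywise (Hadamard) product, applied after $\uparrow_{j+1}$, and the overline is entrywise complex conjugation.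
   Formalization: As stated the filter conditions conflict (1-periodic Fourier series, all zero at ξ=3/4); in the samples and framelets, â and b̂_s are replaced by functions that agree with the Fourier series on [0,1/2] and have supports in [0,1/4] and [0,1/2]; partition of unity is kept for the Fourier series. *)

theory Defs
  imports "HOL-Analysis.Analysis" "HOL-Computational_Algebra.Polynomial"
begin

section \<open>Spherical harmonics on the unit sphere of \<open>\<real>\<^sup>3\<close>\<close>

definition legendre :: "nat \<Rightarrow> real poly" where
  "legendre l = smult (1 / (2 ^ l * fact l)) ((pderiv ^^ l) ([:-1, 0, 1:] ^ l))"

text \<open>Condon--Shortley convention, order \<open>m \<ge> 0\<close>. The factor \<open>(1 - u\<^sup>2)\<^bsup>m/2\<^esup>\<close> is written as a
  natural power of a square root because \<open>0 powr 0 = 0\<close>.\<close>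
definition assoc_legendre :: "nat \<Rightarrow> nat \<Rightarrow> real \<Rightarrow> real" where
  "assoc_legendre l m u = (-1) ^ m * sqrt (1 - u\<^sup>2) ^ m * poly ((pderiv ^^ m) (legendre l)) u"

text \<open>For \<open>x = (sin \<theta> cos \<phi>, sin \<theta> sin \<phi>, cos \<theta>)\<close> one has \<open>cos \<theta> = x $ 3\<close>, and \<open>\<phi>\<close> is the argument of
  \<open>x $ 1 + \<i> x $ 2\<close>. At the poles \<open>\<phi>\<close> is irrelevant since the order-\<open>m\<close> Legendre factor vanishes
  there for \<open>m > 0\<close>.\<close>
definition sph_harm_nonneg :: "nat \<Rightarrow> nat \<Rightarrow> real^3 \<Rightarrow> complex" where
  "sph_harm_nonneg l m x =
     of_real (sqrt ((2 * real l + 1) / (4 * pi) * (fact (l - m) / fact (l + m)))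
                * assoc_legendre l m (x $ 3))
       * cis (real m * Arg (Complex (x $ 1) (x $ 2)))"

definition sph_harm :: "nat \<Rightarrow> int \<Rightarrow> real^3 \<Rightarrow> complex" where
  "sph_harm l m x =
     (if 0 \<le> m then sph_harm_nonneg l (nat m) x
      else (-1) ^ nat (- m) * cnj (sph_harm_nonneg l (nat (- m)) x))"

definition sph_index :: "nat \<Rightarrow> (nat \<times> int) set" where
  "sph_index t = {(l, m). l \<le> t \<and> \<bar>m\<bar> \<le> int l}"

text \<open>Functions on the sphere are represented by functions on \<open>\<real>\<^sup>3\<close> whose values off the sphere
  are immaterial.\<close>
definition sph_poly :: "nat \<Rightarrow> (real^3 \<Rightarrow> complex) set" where
  "sph_poly t =
     {p. \<exists>c. \<forall>x\<in>sphere 0 1. p x = (\<Sum>(l, m)\<in>sph_index t. c l m * sph_harm l m x)}"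

section \<open>Surface measure and spherical designs\<close>

definition sph_coords :: "real \<times> real \<Rightarrow> real^3" where
  "sph_coords = (\<lambda>(\<theta>, \<phi>). vector [sin \<theta> * cos \<phi>, sin \<theta> * sin \<phi>, cos \<theta>])"

text \<open>The area element is \<open>sin \<theta> d\<theta> d\<phi>\<close>. The measure lives on the sphere itself, so that
  measurability does not depend on values off the sphere.\<close>
definition surface_measure :: "(real^3) measure" where
  "surface_measure =
     distr (density (restrict_space lborel ({0..pi} \<times> {0..2*pi})) (\<lambda>(\<theta>, \<phi>). ennreal (sin \<theta>)))
       (restrict_space borel (sphere 0 1)) sph_coords"

definition sph_inner :: "(real^3 \<Rightarrow> complex) \<Rightarrow> (real^3 \<Rightarrow> complex) \<Rightarrow> complex" where
  "sph_inner f g = (LINT x|surface_measure. f x * cnj (g x))"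

definition spherical_design :: "nat \<Rightarrow> nat \<Rightarrow> (nat \<Rightarrow> real^3) \<Rightarrow> bool" where
  "spherical_design t N x \<longleftrightarrow>
     1 \<le> N \<and> (\<forall>i\<in>{1..N}. x i \<in> sphere 0 1) \<and>
     (\<forall>p\<in>sph_poly t. 1 / of_nat N * (\<Sum>i=1..N. p (x i))
        = 1 / of_real (4 * pi) * (LINT y|surface_measure. p y))"

definition qweight :: "nat \<Rightarrow> real" where
  "qweight N = 4 * pi / real N"

section \<open>Filters and framelets\<close>

definition l1_filter :: "(int \<Rightarrow> complex) \<Rightarrow> bool" where
  "l1_filter h \<longleftrightarrow> (\<lambda>k. norm (h k)) summable_on UNIV"

definition fourier_series :: "(int \<Rightarrow> complex) \<Rightarrow> real \<Rightarrow> complex" where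
  "fourier_series h \<xi> = (\<Sum>\<^sub>\<infinity>k\<in>UNIV. h k * exp (- 2 * of_real pi * \<i> * of_int k * of_real \<xi>))"

text \<open>A Fourier series is 1-periodic, so a nonzero one is not supported in \<open>[0, 1/2]\<close> as a function
  on \<open>\<real>\<close>, and the partition of unity on \<open>\<real>\<close> would contradict the support conditions of a filter bank.
  Those conditions speak about the half period \<open>[0, 1/2]\<close>: the symbol that is sampled at the
  frequencies \<open>\<lambda>/t \<in> [0, 1]\<close> agrees with the Fourier series on \<open>[0, 1/2]\<close>, and its
  support is subject to the conditions. A symbol of \<open>h\<close> supported in \<open>[0, 1/2]\<close> is unique;
  if the Fourier series itself were supported there, it would be that symbol.\<close>
definition is_symbol :: "(int \<Rightarrow> complex) \<Rightarrow> (real \<Rightarrow> complex) \<Rightarrow> bool" where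
  "is_symbol h H \<longleftrightarrow> (\<forall>\<xi>\<in>{0..1/2}. H \<xi> = fourier_series h \<xi>)"

definition supp :: "(real \<Rightarrow> complex) \<Rightarrow> real set" where
  "supp H = closure {\<xi>. H \<xi> \<noteq> 0}"

text \<open>\<open>alpha ah t J j l\<close> is the value of the \<open>j\<close>-th scaling symbol at \<open>l / t j\<close>, and likewise for
  \<open>beta\<close>.\<close>
function alpha :: "(real \<Rightarrow> complex) \<Rightarrow> (int \<Rightarrow> nat) \<Rightarrow> int \<Rightarrow> int \<Rightarrow> nat \<Rightarrow> complex" where
  "alpha ah t J j l =
     (if j > J then (if l \<le> t J then 1 else 0)
      else ah (real l / real (t (j + 1))) * alpha ah t J (j + 1) l)"
  by auto
termination by (relation "Wellfounded.measure (\<lambda>(ah, t, J, j, l). nat (J + 1 - j))") auto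

declare alpha.simps [simp del]

definition beta :: "(real \<Rightarrow> complex) \<Rightarrow> (real \<Rightarrow> complex) \<Rightarrow> (int \<Rightarrow> nat) \<Rightarrow> int \<Rightarrow> int \<Rightarrow> nat \<Rightarrow> complex" where
  "beta ah bh t J j l = bh (real l / real (t (j + 1))) * alpha ah t J (j + 1) l"

definition phi_framelet ::
  "(real \<Rightarrow> complex) \<Rightarrow> (int \<Rightarrow> nat) \<Rightarrow> (int \<Rightarrow> nat) \<Rightarrow> (int \<Rightarrow> nat \<Rightarrow> real^3) \<Rightarrow> int
     \<Rightarrow> int \<Rightarrow> nat \<Rightarrow> real^3 \<Rightarrow> complex" where
  "phi_framelet ah t N x J j k y =
     of_real (sqrt (qweight (N j))) *
       (\<Sum>(l, m)\<in>sph_index (t j). alpha ah t J j l * cnj (sph_harm l m (x j k)) * sph_harm l m y)"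

definition psi_framelet ::
  "(real \<Rightarrow> complex) \<Rightarrow> (real \<Rightarrow> complex) \<Rightarrow> (int \<Rightarrow> nat) \<Rightarrow> (int \<Rightarrow> nat) \<Rightarrow> (int \<Rightarrow> nat \<Rightarrow> real^3) \<Rightarrow> int
     \<Rightarrow> int \<Rightarrow> nat \<Rightarrow> real^3 \<Rightarrow> complex" where
  "psi_framelet ah bh t N x J j k y =
     of_real (sqrt (qweight (N (j + 1)))) *
       (\<Sum>(l, m)\<in>sph_index (t (j + 1)).
          beta ah bh t J j l * cnj (sph_harm l m (x (j + 1) k)) * sph_harm l m y)"

section \<open>Vectors and matrices\<close>

text \<open>A vector with index set \<open>I\<close> is a function whose values outside \<open>I\<close> are immaterial; the
  index sets are \<open>{1..N}\<close> for samples and \<open>sph_index t\<close> for spherical harmonic coefficients.\<close>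

definition mat_vec :: "'b set \<Rightarrow> ('a \<Rightarrow> 'b \<Rightarrow> complex) \<Rightarrow> ('b \<Rightarrow> complex) \<Rightarrow> 'a \<Rightarrow> complex" where
  "mat_vec I A c = (\<lambda>i. \<Sum>p\<in>I. A i p * c p)"

definition conj_transpose :: "('a \<Rightarrow> 'b \<Rightarrow> complex) \<Rightarrow> 'b \<Rightarrow> 'a \<Rightarrow> complex" where
  "conj_transpose A = (\<lambda>p i. cnj (A i p))"

definition Y_matrix :: "(nat \<Rightarrow> real^3) \<Rightarrow> nat \<Rightarrow> nat \<times> int \<Rightarrow> complex" where
  "Y_matrix x = (\<lambda>k (l, m). sph_harm l m (x k))"

abbreviation Y_mult :: "nat \<Rightarrow> (nat \<Rightarrow> real^3) \<Rightarrow> (nat \<times> int \<Rightarrow> complex) \<Rightarrow> nat \<Rightarrow> complex" where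
  "Y_mult t x \<equiv> mat_vec (sph_index t) (Y_matrix x)"

abbreviation Y_star_mult :: "nat \<Rightarrow> (nat \<Rightarrow> real^3) \<Rightarrow> (nat \<Rightarrow> complex) \<Rightarrow> nat \<times> int \<Rightarrow> complex" where
  "Y_star_mult N x \<equiv> mat_vec {1..N} (conj_transpose (Y_matrix x))"

definition scale_vec :: "real \<Rightarrow> ('a \<Rightarrow> complex) \<Rightarrow> 'a \<Rightarrow> complex" where
  "scale_vec r u = (\<lambda>p. of_real r * u p)"

definition hadamard :: "('a \<Rightarrow> complex) \<Rightarrow> ('a \<Rightarrow> complex) \<Rightarrow> 'a \<Rightarrow> complex" (infixl "\<odot>\<^sub>v" 70) where
  "u \<odot>\<^sub>v v = (\<lambda>p. u p * v p)"

definition conj_vec :: "('a \<Rightarrow> complex) \<Rightarrow> 'a \<Rightarrow> complex" where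
  "conj_vec u = (\<lambda>p. cnj (u p))"

text \<open>Restriction of a vector on \<open>sph_index t'\<close>, \<open>t \<le> t'\<close>, to \<open>sph_index t\<close>; the zero values are
  only a normalisation.\<close>
definition downsample :: "nat \<Rightarrow> (nat \<times> int \<Rightarrow> complex) \<Rightarrow> nat \<times> int \<Rightarrow> complex" where
  "downsample t c = (\<lambda>p. if p \<in> sph_index t then c p else 0)"

text \<open>Extension by zero of a vector on \<open>sph_index t\<close>, with \<open>t\<close> the \<^emph>\<open>original\<close> degree: the values of
  \<open>c\<close> outside \<open>sph_index t\<close> are discarded.\<close>
definition upsample :: "nat \<Rightarrow> (nat \<times> int \<Rightarrow> complex) \<Rightarrow> nat \<times> int \<Rightarrow> complex" where
  "upsample t c = (\<lambda>p. if p \<in> sph_index t then c p else 0)"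

definition symbol_vec :: "(real \<Rightarrow> complex) \<Rightarrow> nat \<Rightarrow> nat \<times> int \<Rightarrow> complex" where
  "symbol_vec H t = (\<lambda>(l, m). H (real l / real t))"

end

theory Submission
  imports Defs
begin

text \<open>If \<open>f\<close> has harmonic coefficients \<open>c\<close>, then orthonormality shows that \<open>v\<^sub>j\<close> and \<open>w\<^sub>j\<close> sample
  polynomials with coefficients \<open>A \<cdot> cnj a\<close> and \<open>A \<cdot> cnj b\<close>, where \<open>A = c \<cdot> cnj \<alpha>\<close> (with \<open>\<alpha>\<close> the symbol
  at scale \<open>j + 1\<close>) is the coefficient vector of \<open>v\<^bsub>j+1\<^esub>\<close>. The supports of the symbols bound the
  degrees of all these polynomials by half the degree of the design. A product of two harmonics
  of at most half the degree is integrated exactly by the design, so multiplication by \<open>Y\<^sup>*\<close> recovers the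
  coefficients, and the partition of unity gives the reconstruction.

  On the sphere, \<open>Y\<^sub>l\<^sup>m\<close> is a multiple of \<open>z\<^sup>m P(x\<^sub>3)\<close> with \<open>z = x\<^sub>1 + \<i> x\<^sub>2\<close> and \<open>P\<close> the \<open>m\<close>-th
  derivative of the Legendre polynomial, of degree \<open>l - m\<close> (negative \<open>m\<close> conjugates \<open>z\<close>). Orthonormality reduces to
  the Legendre differential equation. Since \<open>z cnj z = 1 - x\<^sub>3\<^sup>2\<close>, products of harmonics again have this
  shape, with the degrees added.\<close>

section \<open>Associated Legendre functions\<close>

abbreviation dlegendre :: "nat \<Rightarrow> nat \<Rightarrow> real poly" where
  "dlegendre l m \<equiv> (pderiv ^^ m) (legendre l)"

text \<open>\<open>W\<close> satisfies the first-order equation (u^2 - 1) W' = 2 l u W.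
  Differentiating it once gives the case n = 0, and every induction step differentiates once
  more.\<close>

lemma rodrigues_ode:
  fixes l n :: nat
  defines "W \<equiv> [:-1, 0, 1::real:] ^ l"
  shows "[:-1, 0, 1:] * (pderiv ^^ (n + 2)) W
           + smult (2 * (real n + 1 - real l)) ([:0, 1:] * (pderiv ^^ (n + 1)) W)
           + smult ((real n + 1) * (real n - 2 * real l)) ((pderiv ^^ n) W) = 0"
proof (induction n)
  case 0
  have *: "[:-1, 0, 1:] * pderiv W = smult (2 * real l) ([:0, 1:] * W)"
  proof (cases l)
    case (Suc k)
    show ?thesis
      unfolding W_def Suc pderiv_power_Suc
      by (subst poly_eq_poly_eq_iff[symmetric], rule ext) (simp add: pderiv_pCons algebra_simps)
  qed (simp add: W_def)
  show ?case
  proof (subst poly_eq_poly_eq_iff[symmetric], rule ext)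
    fix u
    have "poly (pderiv ([:-1, 0, 1:] * pderiv W)) u = poly (pderiv (smult (2 * real l) ([:0, 1:] * W))) u"
      by (simp only: *)
    then show "poly ([:-1, 0, 1:] * (pderiv ^^ (0 + 2)) W
           + smult (2 * (real 0 + 1 - real l)) ([:0, 1:] * (pderiv ^^ (0 + 1)) W)
           + smult ((real 0 + 1) * (real 0 - 2 * real l)) ((pderiv ^^ 0) W)) u = poly 0 u"
      unfolding pderiv_mult by (simp add: pderiv_smult pderiv_pCons pderiv_mult numeral_2_eq_2 algebra_simps del: mult_pCons_left)
  qed
next
  case (Suc n)
  show ?case
  proof (subst poly_eq_poly_eq_iff[symmetric], rule ext)
    fix u
    show "poly ([:-1, 0, 1:] * (pderiv ^^ (Suc n + 2)) W
           + smult (2 * (real (Suc n) + 1 - real l)) ([:0, 1:] * (pderiv ^^ (Suc n + 1)) W)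
           + smult ((real (Suc n) + 1) * (real (Suc n) - 2 * real l)) ((pderiv ^^ (Suc n)) W)) u = poly 0 u"
      using arg_cong[OF Suc.IH, of "\<lambda>p. poly (pderiv p) u"]
      unfolding pderiv_mult pderiv_add pderiv_smult
      by (simp add: pderiv_mult pderiv_pCons algebra_simps del: mult_pCons_left)
  qed
qed

text \<open>Legendre's equation differentiated m times. It is \<open>rodrigues_ode\<close> at n = l
  + m with the sign reversed, because \<open>dlegendre l m\<close> is a constant multiple of the
  derivative of order l + m of (u^2 - 1)^l.\<close>

lemma dlegendre_ode:
  "[:1, 0, -1:] * dlegendre l (m + 2) - smult (2 * (real m + 1)) ([:0, 1:] * dlegendre l (m + 1))
     = smult (- ((real l - real m) * (real l + real m + 1))) (dlegendre l m)"
proof (subst poly_eq_poly_eq_iff[symmetric], rule ext)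
  fix u
  define W where "W = [:-1, 0, 1::real:] ^ l"
  define e where "e = 1 / (2 ^ l * fact l :: real)"
  have D: "dlegendre l k = smult e ((pderiv ^^ (l + k)) W)" for k
    by (simp add: legendre_def W_def e_def higher_pderiv_smult funpow_add add.commute[of l])
  have "e * poly ([:-1, 0, 1:] * (pderiv ^^ (l + m + 2)) W
           + smult (2 * (real (l + m) + 1 - real l)) ([:0, 1:] * (pderiv ^^ (l + m + 1)) W)
           + smult ((real (l + m) + 1) * (real (l + m) - 2 * real l)) ((pderiv ^^ (l + m)) W)) u = 0"
    unfolding W_def rodrigues_ode by simp
  then show "poly ([:1, 0, -1:] * dlegendre l (m + 2) - smult (2 * (real m + 1)) ([:0, 1:] * dlegendre l (m + 1))) u
     = poly (smult (- ((real l - real m) * (real l + real m + 1))) (dlegendre l m)) u"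
    unfolding D by (simp add: algebra_simps)
qed

text \<open>The Sturm-Liouville form of \<open>dlegendre_ode\<close>: the power of 1 - u^2 is the
  integrating factor. This is the form that integration by parts needs.\<close>

lemma pderiv_dlegendre:
  "pderiv ([:1, 0, -1:] ^ Suc m * dlegendre l (Suc m))
     = smult (- ((real l - real m) * (real l + real m + 1))) ([:1, 0, -1:] ^ m * dlegendre l m)"
proof -
  have "pderiv ([:1, 0, -1:] ^ Suc m * dlegendre l (Suc m)) = [:1, 0, -1:] ^ m *
     ([:1, 0, -1:] * dlegendre l (m + 2) - smult (2 * (real m + 1)) ([:0, 1:] * dlegendre l (m + 1)))"
    unfolding pderiv_mult pderiv_power_Suc
    by (subst poly_eq_poly_eq_iff[symmetric], rule ext) (simp add: pderiv_pCons algebra_simps)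
  then show ?thesis
    unfolding dlegendre_ode by simp
qed

lemma degree_dlegendre: "degree (dlegendre l m) = l - m"
  by (simp add: degree_higher_pderiv legendre_def degree_power_eq)

text \<open>The polynomial (u^2 - 1)^l is monic of degree 2 l, so 2 l derivatives leave the constant
  (2 l)!.\<close>

lemma dlegendre_self: "dlegendre l l = [:fact (2 * l) / (2 ^ l * fact l):]"
proof -
  have "degree (dlegendre l l) = 0"
    by (simp add: degree_dlegendre)
  moreover have "coeff ([:-1, 0, 1::real:] ^ l) (2 * l) = 1"
    using lead_coeff_power[of "[:-1, 0, 1::real:]" l] by (simp add: degree_power_eq mult_2_right mult_2)
  then have "coeff (dlegendre l l) 0 = fact (2 * l) / (2 ^ l * fact l)"
    by (simp add: legendre_def higher_pderiv_smult coeff_higher_pderiv pochhammer_fact[symmetric]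
        flip: funpow_add mult_2 comp_apply[of "pderiv ^^ l" "pderiv ^^ l"])
  ultimately show ?thesis
    by (metis degree_eq_zeroE coeff_pCons_0)
qed

text \<open>If it were zero, differentiating l - m more times would make the nonzero constant of
  \<open>dlegendre_self\<close> vanish.\<close>

lemma dlegendre_nonzero: "m \<le> l \<Longrightarrow> dlegendre l m \<noteq> 0"
proof
  assume "m \<le> l" "dlegendre l m = 0"
  then have "dlegendre l l = 0"
    using funpow_add[of "l - m" m "pderiv :: real poly \<Rightarrow> _"] by (metis comp_apply higher_pderiv_0 le_add_diff_inverse2)
  then show False
    by (simp add: dlegendre_self)
qed

section \<open>Integrals of polynomials and inner products of associated Legendre functions\<close>

text \<open>This is \<open>\<integral> p(u) du\<close> over \<open>[-1, 1]\<close> after \<open>u = cos \<theta>\<close>, the form that the surface measure produces, so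
  that no change of variables is needed.\<close>
definition polar_integral :: "real poly \<Rightarrow> real" where
  "polar_integral p = (LBINT \<theta>:{0..pi}. sin \<theta> * poly p (cos \<theta>))"

lemma polar_integrable: "set_integrable lborel {0..pi} (\<lambda>\<theta>. sin \<theta> * poly p (cos \<theta>))"
  by (intro borel_integrable_atLeastAtMost' continuous_intros)

lemma polar_integral_add: "polar_integral (p + q) = polar_integral p + polar_integral q"
  using set_integral_add(2)[OF polar_integrable polar_integrable, of p q]
  by (simp add: polar_integral_def algebra_simps)

lemma polar_integral_smult: "polar_integral (smult c p) = c * polar_integral p"
  unfolding polar_integral_def set_integral_mult_right[symmetric] by (simp add: mult.left_commute)

text \<open>By the chain rule, -p(cos theta) is an antiderivative of the integrand.\<close>

lemma polar_integral_pderiv: "polar_integral (pderiv p) = poly p 1 - poly p (-1)"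
proof -
  have "(LBINT \<theta>:{0..pi}. sin \<theta> * poly (pderiv p) (cos \<theta>)) = - poly p (cos pi) - - poly p (cos 0)"
    unfolding set_lebesgue_integral_def
    by (rule integral_FTC_Icc)
      (auto intro!: derivative_eq_intros continuous_intros
        simp: has_real_derivative_iff_has_vector_derivative[symmetric])
  then show ?thesis
    by (simp add: polar_integral_def)
qed

lemma polar_integral_power:
  "polar_integral ([:1, 0, -1:] ^ l) = 2 * (2 ^ l * fact l)\<^sup>2 / fact (2 * l + 1)"
proof (induction l)
  case 0
  show ?case
    using polar_integral_pderiv[of "[:0, 1:]"] by (simp add: pderiv_pCons one_pCons)
next
  case (Suc l)
  \<comment> \<open>The polynomial u (1 - u^2)^(l+1) vanishes at both endpoints, so integrating its
    derivative gives a recursion in l.\<close>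
  have "pderiv ([:0, 1:] * [:1, 0, -1::real:] ^ Suc l) =
      smult (2 * real l + 3) ([:1, 0, -1:] ^ Suc l) + smult (- 2 * (real l + 1)) ([:1, 0, -1:] ^ l)"
    unfolding pderiv_mult pderiv_power_Suc
    by (subst poly_eq_poly_eq_iff[symmetric], rule ext) (simp add: pderiv_pCons algebra_simps)
  from arg_cong[OF this, of polar_integral]
  have "(2 * real l + 3) * polar_integral ([:1, 0, -1:] ^ Suc l)
      = 2 * (real l + 1) * polar_integral ([:1, 0, -1:] ^ l)"
    unfolding polar_integral_pderiv polar_integral_add polar_integral_smult by (simp add: algebra_simps del: power_Suc)
  then have "polar_integral ([:1, 0, -1:] ^ Suc l)
      = 2 * (real l + 1) / (2 * real l + 3) * (2 * (2 ^ l * fact l)\<^sup>2 / fact (2 * l + 1))"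
    using Suc.IH eq_divide_imp[of "2 * real l + 3" "polar_integral ([:1, 0, -1:] ^ Suc l)"]
    by (simp add: mult.commute del: power_Suc)
  also have "\<dots> = 2 * (2 ^ Suc l * fact (Suc l))\<^sup>2 / fact (2 * Suc l + 1)"
  proof -
    \<comment> \<open>With the factorials and powers replaced by variables, the claim is plain field
      arithmetic.\<close>
    have "2 * c / d * (2 * X\<^sup>2 / F) = 2 * (2 * c * X)\<^sup>2 / (d * (2 * c * F))"
      if "c > 0" "F > 0" "d > 0" for c d X F :: real
      using that by (simp add: field_simps power2_eq_square)
    moreover have "fact (2 * Suc l + 1) = (2 * real l + 3) * (2 * (real l + 1) * fact (2 * l + 1))"
      by (simp add: algebra_simps)
    moreover have "2 ^ Suc l * fact (Suc l) = 2 * (real l + 1) * (2 ^ l * fact l)"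
      by (simp add: algebra_simps)
    ultimately show ?thesis
      by (simp only: add_pos_nonneg zero_less_one of_nat_0_le_iff fact_gt_zero)
  qed
  finally show ?case .
qed

text \<open>The square roots in two associated Legendre functions of equal order m multiply to (1 -
  u^2)^m, so their inner product on [-1, 1] has a polynomial integrand.\<close>

definition legendre_gram :: "nat \<Rightarrow> nat \<Rightarrow> nat \<Rightarrow> real" where
  "legendre_gram m l k = polar_integral ([:1, 0, -1:] ^ m * dlegendre l m * dlegendre k m)"

lemma legendre_gram_commute: "legendre_gram m l k = legendre_gram m k l"
  by (simp add: legendre_gram_def mult.assoc mult.commute[of "dlegendre l m"])

text \<open>Integration by parts with \<open>pderiv_dlegendre\<close>; the boundary terms vanish
  because of the factor 1 - u^2.\<close>

lemma legendre_gram_Suc: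
  "legendre_gram (Suc m) l k = (real l - real m) * (real l + real m + 1) * legendre_gram m l k"
proof -
  have "pderiv (([:1, 0, -1:] ^ Suc m * dlegendre l (Suc m)) * dlegendre k m)
     = [:1, 0, -1:] ^ Suc m * dlegendre l (Suc m) * dlegendre k (Suc m)
       + smult (- ((real l - real m) * (real l + real m + 1)))
           ([:1, 0, -1:] ^ m * dlegendre l m * dlegendre k m)"
    unfolding pderiv_mult[of "_ * _"] pderiv_dlegendre
    by (simp add: mult_ac del: power_Suc mult_pCons_left)
  from arg_cong[OF this, of polar_integral] show ?thesis
    unfolding polar_integral_pderiv polar_integral_add polar_integral_smult legendre_gram_def by (simp del: mult_pCons_left)
qed

text \<open>The usual argument for a self-adjoint operator: by symmetry
  \<open>legendre_gram_Suc\<close> can be applied with either degree as the first one, and the two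
  eigenvalues differ by (l - k)(l + k + 1).\<close>

lemma legendre_gram_orthogonal:
  assumes "l \<noteq> k"
  shows "legendre_gram m l k = 0"
proof -
  have "(real l - real m) * (real l + real m + 1) * legendre_gram m l k
      = (real k - real m) * (real k + real m + 1) * legendre_gram m l k"
    using legendre_gram_Suc[of m l k] legendre_gram_Suc[of m k l]
    unfolding legendre_gram_commute[of _ k l] by (simp only:)
  then have "(real l - real k) * (real l + real k + 1) * legendre_gram m l k = 0"
    by (simp add: algebra_simps)
  moreover have "real l + real k + 1 \<noteq> 0"
    by linarith
  ultimately show ?thesis
    using assms by simp
qed

lemma legendre_gram_self:
  assumes "m \<le> l"
  shows "legendre_gram m l l = 2 / (2 * real l + 1) * (fact (l + m) / fact (l - m))"
  using assms
\<comment> \<open>Downward from m = l, where the derivative is constant and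
  \<open>polar_integral_power\<close> applies; the step divides \<open>legendre_gram_Suc\<close> by
  its nonzero factor.\<close>
proof (induction rule: inc_induct)
  case base
  have "[:1, 0, -1:] ^ l * dlegendre l l * dlegendre l l
      = smult ((fact (2 * l) / (2 ^ l * fact l))\<^sup>2) ([:1, 0, -1:] ^ l)"
    by (simp add: dlegendre_self power2_eq_square)
  then have "legendre_gram l l l
      = (fact (2 * l) / (2 ^ l * fact l))\<^sup>2 * (2 * (2 ^ l * fact l)\<^sup>2 / fact (2 * l + 1))"
    by (simp add: legendre_gram_def polar_integral_smult polar_integral_power)
  also have "\<dots> = 2 * fact (2 * l) / (2 * real l + 1)"
  proof -
    have "(F / X)\<^sup>2 * (2 * X\<^sup>2 / ((2 * real l + 1) * F)) = 2 * F / (2 * real l + 1)"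
      if "F \<noteq> 0" "X \<noteq> 0" for F X :: real
      using that by (simp add: power2_eq_square)
    from this[of "fact (2 * l)" "2 ^ l * fact l"] show ?thesis
      by (simp add: add.commute[of 1])
  qed
  finally show ?case
    by (simp add: mult_2[of l])
next
  case (step m)
  have "(real l - real m) * (real l + real m + 1) \<noteq> 0"
    using step.hyps by simp
  moreover have "(real l - real m) * (real l + real m + 1)
      * (2 / (2 * real l + 1) * (fact (l + m) / fact (l - m)))
      = 2 / (2 * real l + 1) * (fact (l + Suc m) / fact (l - Suc m))"
  proof -
    have pred: "fact (l - m) = (real l - real m) * fact (l - Suc m)"
      using step.hyps fact_Suc[of "l - Suc m", where 'a = real] by (simp add: Suc_diff_Suc of_nat_diff)
    have succ: "fact (l + Suc m) = (real l + real m + 1) * fact (l + m)"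
      by (simp add: algebra_simps)
    show ?thesis
      unfolding pred succ using step.hyps by simp
  qed
  ultimately show ?case
    using step.IH unfolding legendre_gram_Suc by (metis mult_left_cancel)
qed

section \<open>Integration over the sphere\<close>

lemma continuous_on_sph_coords: "continuous_on S sph_coords"
  unfolding sph_coords_def vector_def case_prod_unfold
proof (intro continuous_on_vec_lambda)
  fix i :: 3
  show "continuous_on S (\<lambda>x. foldr (\<lambda>x f n. (f (n + 1)) (n := x))
      [sin (fst x) * cos (snd x), sin (fst x) * sin (snd x), cos (fst x)] (\<lambda>n x. 0) 1 i)"
    using exhaust_3[of i] by (auto intro!: continuous_intros)
qed

lemma sph_coords_components [simp]:
  "sph_coords (\<theta>, \<phi>) $ 1 = sin \<theta> * cos \<phi>"
  "sph_coords (\<theta>, \<phi>) $ 2 = sin \<theta> * sin \<phi>"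
  "sph_coords (\<theta>, \<phi>) $ 3 = cos \<theta>"
  by (simp_all add: sph_coords_def)

lemma norm_vec3: "(norm (y :: real^3))\<^sup>2 = (y $ 1)\<^sup>2 + (y $ 2)\<^sup>2 + (y $ 3)\<^sup>2"
  unfolding power2_norm_eq_inner by (simp add: inner_vec_def sum_3 power2_eq_square)

lemma sph_coords_in_sphere: "sph_coords p \<in> sphere 0 1"
proof (cases p)
  case (Pair \<theta> \<phi>)
  have "(norm (sph_coords p))\<^sup>2 = (sin \<theta>)\<^sup>2 * ((cos \<phi>)\<^sup>2 + (sin \<phi>)\<^sup>2) + (cos \<theta>)\<^sup>2"
    unfolding Pair norm_vec3 by (simp add: power_mult_distrib distrib_left del: sin_cos_squared_add sin_cos_squared_add2)
  then have "(norm (sph_coords p))\<^sup>2 = 1"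
    by simp
  then show ?thesis
    by (simp add: abs_square_eq_1)
qed

lemma space_surface_measure [simp]: "space surface_measure = sphere 0 1"
  by (simp add: surface_measure_def space_restrict_space)

context
  fixes F :: "real^3 \<Rightarrow> complex"
  assumes cont: "continuous_on (sphere 0 1) F"
begin

lemma continuous_on_pullback: "continuous_on S (\<lambda>p. sin (fst p) *\<^sub>R F (sph_coords p))"
proof -
  have "continuous_on S (\<lambda>p. F (sph_coords p))"
    using sph_coords_in_sphere by (intro continuous_on_compose2[OF cont continuous_on_sph_coords]) auto
  then show ?thesis
    by (intro continuous_intros)
qed

lemma integrable_pullback:
  "integrable lborel (\<lambda>p. indicator ({0..pi} \<times> {0..2*pi}) p *\<^sub>R (sin (fst p) *\<^sub>R F (sph_coords p)))"
  by (intro borel_integrable_compact compact_Times compact_Icc continuous_on_pullback)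

text \<open>The image measure, the density and the restriction that make up
  \<open>surface_measure\<close> are unfolded in turn; what remains is a continuous integrand on a
  compact rectangle.\<close>

lemma surface_pullback:
  "integrable surface_measure F"
  "(LINT y|surface_measure. F y)
     = (LINT p|lborel. indicator ({0..pi} \<times> {0..2*pi}) p *\<^sub>R (sin (fst p) *\<^sub>R F (sph_coords p)))"
proof -
  let ?R = "{0..pi} \<times> {0..2*pi}"
  let ?M = "restrict_space lborel ?R"
  have R: "?R \<inter> space lborel \<in> sets lborel"
    by (auto intro!: borel_closed closed_Times)
  have density_eq: "density ?M (\<lambda>(\<theta>, \<phi>). ennreal (sin \<theta>)) = density ?M (\<lambda>p. ennreal (sin (fst p)))"
    by (simp add: case_prod_unfold)
  have coords: "sph_coords \<in> measurable (density ?M (\<lambda>p. ennreal (sin (fst p)))) (restrict_space borel (sphere 0 1))"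
    using sph_coords_in_sphere borel_measurable_continuous_onI[OF continuous_on_sph_coords]
    by (intro measurable_restrict_space2) (auto intro!: measurable_restrict_space1)
  have F: "F \<in> borel_measurable (restrict_space borel (sphere 0 1))"
    by (rule borel_measurable_continuous_on_restrict[OF cont])
  have G: "(\<lambda>p. F (sph_coords p)) \<in> borel_measurable ?M"
    using measurable_compose[OF coords F] by simp
  have S: "(\<lambda>p. sin (fst p)) \<in> borel_measurable ?M"
    by (intro measurable_restrict_space1 borel_measurable_continuous_onI continuous_intros)
      (simp add: borel_measurable_continuous_onI continuous_intros)
  \<comment> \<open>Nonnegativity lets the \<open>ennreal\<close> density become the real factor sin
    theta.\<close>
  have pos: "AE p in ?M. 0 \<le> sin (fst p)"
    by (rule AE_I2) (auto simp: space_restrict_space sin_ge_zero)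
  show "integrable surface_measure F"
    unfolding surface_measure_def density_eq integrable_distr_eq[OF coords F]
      integrable_density[OF G S pos] integrable_restrict_space[OF R]
    by (rule integrable_pullback)
  show "(LINT y|surface_measure. F y)
     = (LINT p|lborel. indicator ?R p *\<^sub>R (sin (fst p) *\<^sub>R F (sph_coords p)))"
    unfolding surface_measure_def density_eq integral_distr[OF coords F]
      integral_density[OF G S pos] integral_restrict_space[OF R] ..
qed

text \<open>Fubini: the indicator of the rectangle factors along with the integrand.\<close>

lemma surface_integral_separable:
  assumes FGH: "\<And>\<theta> \<phi>. F (sph_coords (\<theta>, \<phi>)) = of_real (G \<theta>) * H \<phi>"
  shows "(LINT y|surface_measure. F y) = of_real (LBINT \<theta>:{0..pi}. sin \<theta> * G \<theta>) * (LBINT \<phi>:{0..2*pi}. H \<phi>)"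
proof -
  have *: "indicator ({0..pi} \<times> {0..2*pi}) (\<theta>, \<phi>) *\<^sub>R (sin (fst (\<theta>, \<phi>)) *\<^sub>R F (sph_coords (\<theta>, \<phi>)))
      = of_real (indicator {0..pi} \<theta> *\<^sub>R (sin \<theta> * G \<theta>)) * (indicator {0..2*pi} \<phi> *\<^sub>R H \<phi>)" for \<theta> \<phi>
    by (auto simp: FGH indicator_def scaleR_conv_of_real)
  have "(LINT y|surface_measure. F y) = (LBINT \<theta>. LBINT \<phi>.
      indicator ({0..pi} \<times> {0..2*pi}) (\<theta>, \<phi>) *\<^sub>R (sin (fst (\<theta>, \<phi>)) *\<^sub>R F (sph_coords (\<theta>, \<phi>))))"
    unfolding surface_pullback(2)
    using lborel_pair.integral_fst'[of "\<lambda>p. indicator ({0..pi} \<times> {0..2*pi}) p *\<^sub>R (sin (fst p) *\<^sub>R F (sph_coords p))"]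
      integrable_pullback
    unfolding lborel_prod by simp
  also have "\<dots> = of_real (LBINT \<theta>:{0..pi}. sin \<theta> * G \<theta>) * (LBINT \<phi>:{0..2*pi}. H \<phi>)"
    unfolding * set_lebesgue_integral_def
    by (simp only: integral_mult_right_zero integral_mult_left_zero integral_complex_of_real)
  finally show ?thesis .
qed

end

text \<open>The antiderivative cis(k phi) / (i k) takes the same value at 0 and 2 pi.\<close>

lemma integral_cis:
  fixes k :: int
  assumes "k \<noteq> 0"
  shows "(LBINT \<phi>:{0..2*pi}. cis (of_int k * \<phi>)) = 0"
proof -
  have "(LBINT \<phi>:{0..2*pi}. cis (of_int k * \<phi>))
      = cis (of_int k * (2 * pi)) / (\<i> * of_int k) - cis (of_int k * 0) / (\<i> * of_int k)"
    unfolding set_lebesgue_integral_def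
  proof (rule integral_FTC_Icc)
    fix \<phi> :: real
    have "((\<lambda>\<phi>. exp (\<i> * of_int k * of_real \<phi>) / (\<i> * of_int k)) has_vector_derivative
        exp (\<i> * of_int k * of_real \<phi>)) (at \<phi> within {0..2*pi})"
      by (rule has_vector_derivative_real_field) (use assms in \<open>auto intro!: derivative_eq_intros\<close>)
    then show "((\<lambda>\<phi>. cis (of_int k * \<phi>) / (\<i> * of_int k)) has_vector_derivative cis (of_int k * \<phi>))
        (at \<phi> within {0..2*pi})"
      by (simp add: cis_conv_exp mult.assoc)
  qed (auto intro!: continuous_intros)
  moreover have "cis (of_int k * (2 * pi)) = 1"
    using cis_multiple_2pi[of "of_int k"] by (simp add: mult_ac)
  ultimately show ?thesis
    by simp
qed

section \<open>Spherical harmonics\<close>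

text \<open>In spherical coordinates this is sin^|m| theta times e^(i m phi). Being polynomial in
  the coordinates, it avoids \<open>Arg\<close> and is continuous at the poles.\<close>

definition azimuthal :: "int \<Rightarrow> real^3 \<Rightarrow> complex" where
  "azimuthal m y = (if 0 \<le> m then Complex (y $ 1) (y $ 2) ^ nat m else cnj (Complex (y $ 1) (y $ 2)) ^ nat (- m))"

definition zonal_mult :: "int \<Rightarrow> real poly \<Rightarrow> real^3 \<Rightarrow> complex" where
  "zonal_mult m p y = azimuthal m y * of_real (poly p (y $ 3))"

text \<open>The sign occurs only for m >= 0: for negative orders the factor in
  \<open>sph_harm\<close> cancels the Condon-Shortley sign.\<close>

definition harm_const :: "nat \<Rightarrow> int \<Rightarrow> real" where
  "harm_const l m = (if 0 \<le> m then (-1) ^ nat m else 1)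
     * sqrt ((2 * real l + 1) / (4 * pi) * (fact (l - nat \<bar>m\<bar>) / fact (l + nat \<bar>m\<bar>)))"

lemma harm_const_nonzero: "harm_const l m \<noteq> 0"
  by (simp add: harm_const_def add_eq_0_iff)

lemma harm_const_square:
  "(harm_const l m)\<^sup>2 = (2 * real l + 1) / (4 * pi) * (fact (l - nat \<bar>m\<bar>) / fact (l + nat \<bar>m\<bar>))"
  by (simp add: harm_const_def power_mult_distrib power_mult[symmetric] mult.commute[of _ 2] power_mult)

lemma azimuthal_minus: "azimuthal (- m) y = cnj (azimuthal m y)"
  by (auto simp: azimuthal_def)

lemma azimuthal_sph_coords:
  "azimuthal m (sph_coords (\<theta>, \<phi>)) = of_real (sin \<theta> ^ nat \<bar>m\<bar>) * cis (of_int m * \<phi>)"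
proof -
  have eq: "Complex (sin \<theta> * cos \<phi>) (sin \<theta> * sin \<phi>) = of_real (sin \<theta>) * cis \<phi>"
    by (simp add: complex_eq_iff)
  show ?thesis
    unfolding azimuthal_def sph_coords_components eq
    using Complex.DeMoivre[of \<phi> "nat m"] Complex.DeMoivre[of "- \<phi>" "nat (- m)"]
    by (cases "0 \<le> m") (simp_all add: power_mult_distrib cis_cnj)
qed

lemma continuous_on_azimuthal: "continuous_on S (azimuthal m)"
  unfolding azimuthal_def complex_eq by (cases "0 \<le> m") (auto intro!: continuous_intros)

lemma continuous_on_zonal_mult: "continuous_on S (zonal_mult m p)"
  unfolding zonal_mult_def by (intro continuous_intros continuous_on_azimuthal)

lemma sphere3_iff: "y \<in> sphere 0 1 \<longleftrightarrow> (y $ 1)\<^sup>2 + (y $ 2)\<^sup>2 = 1 - (y $ 3)\<^sup>2" for y :: "real^3"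
  using norm_vec3[of y] by (auto simp: algebra_simps abs_square_eq_1)

text \<open>On the sphere sqrt(1 - y_3^2) is the modulus of z = y_1 + i y_2, so the square root and
  the phase combine to z, and their m-th powers to z^m.\<close>

lemma sph_harm_nonneg_eq:
  assumes "y \<in> sphere 0 1"
  shows "sph_harm_nonneg l m y = of_real (harm_const l (int m)) * zonal_mult (int m) (dlegendre l m) y"
proof -
  define z where "z = Complex (y $ 1) (y $ 2)"
  have "cmod z = sqrt (1 - (y $ 3)\<^sup>2)"
    using assms unfolding z_def sphere3_iff by (simp add: cmod_def)
  then have "of_real (sqrt (1 - (y $ 3)\<^sup>2)) * cis (Arg z) = z"
    using rcis_cmod_Arg[of z] by (simp add: rcis_def)
  then have "of_real (sqrt (1 - (y $ 3)\<^sup>2) ^ m) * cis (real m * Arg z) = z ^ m"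
    by (metis Complex.DeMoivre of_real_power power_mult_distrib)
  then show ?thesis
    unfolding sph_harm_nonneg_def assoc_legendre_def harm_const_def zonal_mult_def azimuthal_def
      z_def[symmetric]
    by (simp add: mult_ac)
qed

lemma sph_harm_eq:
  assumes "y \<in> sphere 0 1"
  shows "sph_harm l m y = of_real (harm_const l m) * zonal_mult m (dlegendre l (nat \<bar>m\<bar>)) y"
proof (cases "0 \<le> m")
  case True
  then show ?thesis
    using sph_harm_nonneg_eq[OF assms, of l "nat m"] by (simp add: sph_harm_def)
next
  case False
  have "(-1) ^ nat (- m) * cnj (sph_harm_nonneg l (nat (- m)) y)
     = ((-1) ^ nat (- m) * of_real (harm_const l (- m)))
         * (cnj (azimuthal (- m) y) * of_real (poly (dlegendre l (nat (- m))) (y $ 3)))"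
    using False by (simp add: sph_harm_nonneg_eq[OF assms] zonal_mult_def)
  also have "(-1) ^ nat (- m) * complex_of_real (harm_const l (- m)) = of_real (harm_const l m)"
    using False by (simp add: harm_const_def mult.assoc[symmetric] power_add[symmetric] mult_2[symmetric])
  also have "cnj (azimuthal (- m) y) = azimuthal m y"
    by (simp add: azimuthal_minus)
  finally show ?thesis
    using False by (simp add: sph_harm_def zonal_mult_def)
qed

text \<open>Orders of opposite sign leave \<open>e\<close> pairs z cnj z, each equal to 1 - y_3^2.
  The first claim is the degree count: every pair uses up two powers.\<close>

lemma azimuthal_mult:
  fixes m k :: int
  defines "e \<equiv> if (0 \<le> m) = (0 \<le> k) then 0 else min (nat \<bar>m\<bar>) (nat \<bar>k\<bar>)"
  shows "nat \<bar>m\<bar> + nat \<bar>k\<bar> = nat \<bar>m + k\<bar> + 2 * e"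
    and "y \<in> sphere 0 1 \<Longrightarrow>
      azimuthal m y * azimuthal k y = azimuthal (m + k) y * of_real (poly ([:1, 0, -1:] ^ e) (y $ 3))"
proof -
  show "nat \<bar>m\<bar> + nat \<bar>k\<bar> = nat \<bar>m + k\<bar> + 2 * e"
    by (cases "0 \<le> m"; cases "0 \<le> k") (auto simp: e_def min_def)
  assume y: "y \<in> sphere 0 1"
  define z where "z = Complex (y $ 1) (y $ 2)"
  have z: "of_real (poly ([:1, 0, -1:] ^ e) (y $ 3)) = (z * cnj z) ^ e" for e
    using y unfolding sphere3_iff by (simp add: complex_mult_cnj z_def power2_eq_square)
  have opposite: "azimuthal (int i) y * azimuthal (- int j) y = azimuthal (int i - int j) y * (z * cnj z) ^ min i j" for i j
  proof (cases "j \<le> i")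
    case True
    then obtain d where "i = j + d"
      using le_Suc_ex by blast
    then show ?thesis
      \<comment> \<open>The case j = 0 is separate because \<open>- int 0\<close> selects the
        nonnegative branch of \<open>azimuthal\<close>.\<close>
      by (cases "j = 0") (simp_all add: azimuthal_def z_def[symmetric] power_mult_distrib power_add nat_int_add)
  next
    case False
    then obtain d where d: "j = Suc (i + d)"
      using less_imp_Suc_add[of i j] by auto
    then have "cnj z ^ j = cnj z ^ Suc d * cnj z ^ i" "nat (int j - int i) = Suc d"
      by (simp_all add: power_add)
    with False show ?thesis
      by (simp add: azimuthal_def z_def[symmetric] power_mult_distrib min_def del: power_Suc)
  qed
  show "azimuthal m y * azimuthal k y = azimuthal (m + k) y * of_real (poly ([:1, 0, -1:] ^ e) (y $ 3))"
    unfolding z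
  proof (cases "0 \<le> m"; cases "0 \<le> k")
    assume "0 \<le> m" "0 \<le> k"
    then show "azimuthal m y * azimuthal k y = azimuthal (m + k) y * (z * cnj z) ^ e"
      by (simp add: e_def azimuthal_def nat_add_distrib power_add)
  next
    assume "\<not> 0 \<le> m" "\<not> 0 \<le> k"
    moreover from this have "nat (- (m + k)) = nat (- m) + nat (- k)"
      by simp
    ultimately show "azimuthal m y * azimuthal k y = azimuthal (m + k) y * (z * cnj z) ^ e"
      unfolding azimuthal_def by (simp only: power_add) (simp add: e_def)
  next
    assume "0 \<le> m" "\<not> 0 \<le> k"
    then show "azimuthal m y * azimuthal k y = azimuthal (m + k) y * (z * cnj z) ^ e"
      using opposite[of "nat m" "nat (- k)"] by (simp add: e_def)
  next
    assume "\<not> 0 \<le> m" "0 \<le> k"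
    then show "azimuthal m y * azimuthal k y = azimuthal (m + k) y * (z * cnj z) ^ e"
      using opposite[of "nat k" "nat (- m)"]
      by (simp add: e_def mult.commute[of "azimuthal m y"] min.commute[of "nat (- m)"] add.commute[of m])
  qed
qed

section \<open>Polynomial spaces on the sphere and products of harmonics\<close>

lemma finite_sph_index: "finite (sph_index t)"
proof (rule finite_subset)
  show "sph_index t \<subseteq> {..t} \<times> {- int t..int t}"
    by (auto simp: sph_index_def)
qed simp

lemma sph_poly_cong: "p \<in> sph_poly t \<Longrightarrow> (\<And>y. y \<in> sphere 0 1 \<Longrightarrow> q y = p y) \<Longrightarrow> q \<in> sph_poly t"
  unfolding sph_poly_def by fastforce

lemma sph_poly_zero: "(\<lambda>y. 0) \<in> sph_poly t"
  unfolding sph_poly_def by (auto intro!: exI[of _ "\<lambda>l m. 0"])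

lemma sph_poly_add:
  assumes "p \<in> sph_poly t" "q \<in> sph_poly t"
  shows "(\<lambda>y. p y + q y) \<in> sph_poly t"
proof -
  obtain c d where "\<forall>y\<in>sphere 0 1. p y = (\<Sum>(l, m)\<in>sph_index t. c l m * sph_harm l m y)"
      "\<forall>y\<in>sphere 0 1. q y = (\<Sum>(l, m)\<in>sph_index t. d l m * sph_harm l m y)"
    using assms by (auto simp: sph_poly_def)
  then show ?thesis
    unfolding sph_poly_def
    by (auto intro!: exI[of _ "\<lambda>l m. c l m + d l m"]
        simp: sum.distrib[symmetric] case_prod_unfold distrib_right)
qed

lemma sph_poly_scale:
  assumes "p \<in> sph_poly t"
  shows "(\<lambda>y. a * p y) \<in> sph_poly t"
proof -
  obtain c where "\<forall>y\<in>sphere 0 1. p y = (\<Sum>(l, m)\<in>sph_index t. c l m * sph_harm l m y)"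
    using assms by (auto simp: sph_poly_def)
  then show ?thesis
    unfolding sph_poly_def
    by (auto intro!: exI[of _ "\<lambda>l m. a * c l m"] simp: sum_distrib_left case_prod_unfold mult.assoc)
qed

lemma sph_harm_in_sph_poly:
  assumes "(l, m) \<in> sph_index t"
  shows "sph_harm l m \<in> sph_poly t"
proof -
  have "(\<Sum>(l', m')\<in>sph_index t. (if l' = l \<and> m' = m then 1 else 0) * sph_harm l' m' y)
      = (\<Sum>q\<in>sph_index t. if q = (l, m) then sph_harm l m y else 0)" for y
    by (rule sum.cong) (auto split: if_splits)
  then show ?thesis
    unfolding sph_poly_def using assms finite_sph_index[of t]
    by (auto intro!: exI[of _ "\<lambda>l' m'. if l' = l \<and> m' = m then 1 else 0"])
qed

text \<open>The derivatives \<open>dlegendre (d + \<bar>m\<bar>) \<bar>m\<bar>\<close> have exact degree \<open>d\<close>, so leading terms can be removed one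
  at a time.\<close>
lemma zonal_mult_in_sph_poly:
  "degree p + nat \<bar>m\<bar> \<le> t \<Longrightarrow> zonal_mult m p \<in> sph_poly t"
proof (induction "degree p" arbitrary: p rule: less_induct)
  case less
  define l where "l = degree p + nat \<bar>m\<bar>"
  define B where "B = dlegendre l (nat \<bar>m\<bar>)"
  define c where "c = lead_coeff p / lead_coeff B"
  define r where "r = p - smult c B"
  have B: "degree B = degree p" "B \<noteq> 0"
    by (simp_all add: B_def l_def degree_dlegendre dlegendre_nonzero)
  have "degree r \<le> degree p"
    unfolding r_def using B by (intro degree_diff_le) auto
  moreover have "coeff r (degree p) = 0"
    using B leading_coeff_neq_0[of B] by (simp add: r_def c_def)
  \<comment> \<open>The alternative r = 0 ends the induction when p is constant.\<close>
  ultimately have "r = 0 \<or> degree r < degree p"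
    by (metis eq_zero_or_degree_less)
  then have r: "zonal_mult m r \<in> sph_poly t"
    using less sph_poly_zero by (auto simp: zonal_mult_def[abs_def])
  have "sph_harm l m \<in> sph_poly t"
    using less.prems by (intro sph_harm_in_sph_poly) (auto simp: sph_index_def l_def)
  note sph_poly_add[OF sph_poly_scale[OF this, of "of_real (c / harm_const l m)"] r]
  then show ?case
  proof (rule sph_poly_cong)
    fix y :: "real^3"
    assume "y \<in> sphere 0 1"
    moreover have "p = smult c B + r"
      by (simp add: r_def)
    then have "poly p (y $ 3) = c * poly B (y $ 3) + poly r (y $ 3)"
      by (metis poly_add poly_smult)
    ultimately show "zonal_mult m p y = of_real (c / harm_const l m) * sph_harm l m y + zonal_mult m r y"
      by (simp add: sph_harm_eq zonal_mult_def B_def[symmetric] harm_const_nonzero algebra_simps)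
  qed
qed

text \<open>The product has order m - m' and a polynomial factor of degree at most 2 e + (l - |m|) +
  (l' - |m'|). Adding |m - m'| gives l + l', by the degree count of
  \<open>azimuthal_mult\<close>.\<close>

lemma sph_harm_mult_cnj_in_sph_poly:
  assumes "\<bar>m\<bar> \<le> int l" "\<bar>m'\<bar> \<le> int l'" "l + l' \<le> t"
  shows "(\<lambda>y. sph_harm l m y * cnj (sph_harm l' m' y)) \<in> sph_poly t"
proof -
  define e where "e = (if (0 \<le> m) = (0 \<le> - m') then 0 else min (nat \<bar>m\<bar>) (nat \<bar>- m'\<bar>))"
  note e = azimuthal_mult[where m = m and k = "- m'", folded e_def]
  define P P' where "P = dlegendre l (nat \<bar>m\<bar>)" and "P' = dlegendre l' (nat \<bar>m'\<bar>)"
  have "degree ([:1, 0, -1:] ^ e * P * P') \<le> 2 * e + (l - nat \<bar>m\<bar>) + (l' - nat \<bar>m'\<bar>)"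
    unfolding P_def P'_def degree_dlegendre[symmetric]
    by (intro order.trans[OF degree_mult_le] add_mono order.refl) (simp add: degree_power_eq)
  moreover have "nat \<bar>m\<bar> \<le> l" "nat \<bar>m'\<bar> \<le> l'"
    using assms(1,2) by auto
  ultimately have "degree ([:1, 0, -1:] ^ e * P * P') + nat \<bar>m + - m'\<bar> \<le> t"
    using e(1) assms(3) unfolding abs_minus_cancel by linarith
  then have "zonal_mult (m + - m') ([:1, 0, -1:] ^ e * P * P') \<in> sph_poly t"
    by (rule zonal_mult_in_sph_poly)
  from sph_poly_scale[OF this, of "of_real (harm_const l m * harm_const l' m')"] show ?thesis
  proof (rule sph_poly_cong)
    fix y :: "real^3"
    assume y: "y \<in> sphere 0 1"
    have "sph_harm l m y * cnj (sph_harm l' m' y) = of_real (harm_const l m * harm_const l' m')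
        * ((azimuthal m y * azimuthal (- m') y) * of_real (poly (P * P') (y $ 3)))"
      unfolding sph_harm_eq[OF y] by (simp add: zonal_mult_def azimuthal_minus P_def P'_def mult_ac)
    also have "\<dots> = of_real (harm_const l m * harm_const l' m')
        * zonal_mult (m + - m') ([:1, 0, -1:] ^ e * P * P') y"
      unfolding e(2)[OF y] by (simp add: zonal_mult_def mult_ac)
    finally show "sph_harm l m y * cnj (sph_harm l' m' y) = of_real (harm_const l m * harm_const l' m')
        * zonal_mult (m + - m') ([:1, 0, -1:] ^ e * P * P') y" .
  qed
qed

section \<open>Continuous and discrete orthonormality\<close>

text \<open>In spherical coordinates the integral separates. The azimuthal factor vanishes for
  different orders; for equal orders the polar factor is a \<open>legendre_gram\<close> integral,
  which \<open>harm_const\<close> normalises.\<close>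

lemma sph_harm_orthonormal:
  assumes "\<bar>m\<bar> \<le> int l" "\<bar>m'\<bar> \<le> int l'"
  shows "integrable surface_measure (\<lambda>y. sph_harm l m y * cnj (sph_harm l' m' y))"
    and "(LINT y|surface_measure. sph_harm l m y * cnj (sph_harm l' m' y)) = (if l = l' \<and> m = m' then 1 else 0)"
proof -
  define P P' where "P = dlegendre l (nat \<bar>m\<bar>)" and "P' = dlegendre l' (nat \<bar>m'\<bar>)"
  define K where "K = harm_const l m * harm_const l' m'"
  \<comment> \<open>\<open>F\<close> agrees with the product on the sphere and, being free of
    \<open>Arg\<close>, is continuous.\<close>
  define F where "F = (\<lambda>y. of_real K * (zonal_mult m P y * cnj (zonal_mult m' P' y)))"
  have FY: "sph_harm l m y * cnj (sph_harm l' m' y) = F y" if "y \<in> space surface_measure" for y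
    using that by (simp add: sph_harm_eq F_def K_def P_def P'_def del: mem_sphere_0)
  have F: "continuous_on (sphere 0 1) F"
    unfolding F_def by (intro continuous_intros continuous_on_zonal_mult)
  show "integrable surface_measure (\<lambda>y. sph_harm l m y * cnj (sph_harm l' m' y))"
    using surface_pullback(1)[OF F] by (subst Bochner_Integration.integrable_cong[OF refl FY])
  let ?G = "\<lambda>\<theta>. K * sin \<theta> ^ (nat \<bar>m\<bar> + nat \<bar>m'\<bar>) * (poly P (cos \<theta>) * poly P' (cos \<theta>))"
  have G: "F (sph_coords (\<theta>, \<phi>)) = of_real (?G \<theta>) * cis (of_int (m - m') * \<phi>)" for \<theta> \<phi>
  proof -
    have "cis (of_int (m - m') * \<phi>) = cis (of_int m * \<phi>) * cis (- (of_int m' * \<phi>))"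
      by (simp add: cis_mult left_diff_distrib)
    then show ?thesis
      by (simp add: F_def zonal_mult_def azimuthal_sph_coords cis_cnj power_add)
  qed
  have eq: "(LINT y|surface_measure. sph_harm l m y * cnj (sph_harm l' m' y))
      = of_real (LBINT \<theta>:{0..pi}. sin \<theta> * ?G \<theta>) * (LBINT \<phi>:{0..2*pi}. cis (of_int (m - m') * \<phi>))"
    using surface_integral_separable[OF F G] by (subst Bochner_Integration.integral_cong[OF refl FY])
  show "(LINT y|surface_measure. sph_harm l m y * cnj (sph_harm l' m' y)) = (if l = l' \<and> m = m' then 1 else 0)"
  proof (cases "m = m'")
    case True
    have "(LBINT \<theta>:{0..pi}. sin \<theta> * ?G \<theta>) = polar_integral (smult K ([:1, 0, -1:] ^ nat \<bar>m\<bar> * P * P'))"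
    proof -
      have "sin \<theta> * sin \<theta> = 1 - cos \<theta> * cos \<theta>" for \<theta> :: real
        using sin_squared_eq[of \<theta>] by (simp add: power2_eq_square)
      then have "sin \<theta> ^ (i + i) = (1 - cos \<theta> * cos \<theta>) ^ i" for \<theta> :: real and i
        by (simp add: power_add power_mult_distrib[symmetric])
      then show ?thesis
        unfolding polar_integral_def True by (simp add: mult_ac)
    qed
    also have "\<dots> = K * legendre_gram (nat \<bar>m\<bar>) l l'"
      unfolding polar_integral_smult legendre_gram_def P_def P'_def True ..
    \<comment> \<open>The remaining 1 / (2 pi) cancels against the azimuthal integral of the
      constant 1.\<close>
    also have "\<dots> = (if l = l' then 1 / (2 * pi) else 0)"
      using assms True legendre_gram_orthogonal[of l l'] legendre_gram_self[of "nat \<bar>m\<bar>" l] harm_const_square[of l m]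
      by (auto simp: K_def power2_eq_square[symmetric])
    finally show ?thesis
      unfolding eq using True by (auto simp: set_lebesgue_integral_def scaleR_conv_of_real)
  next
    case False
    then show ?thesis
      unfolding eq using integral_cis[of "m - m'"] by simp
  qed
qed

text \<open>The product of the two harmonics lies in \<open>sph_poly t\<close>, so the design
  replaces its integral by the weighted sum and orthonormality carries over to the sample
  points.\<close>

lemma design_quadrature:
  assumes "spherical_design t N x" "\<bar>m\<bar> \<le> int l" "\<bar>m'\<bar> \<le> int l'" "l + l' \<le> t"
  shows "of_real (qweight N) * (\<Sum>k=1..N. sph_harm l m (x k) * cnj (sph_harm l' m' (x k)))
      = (if l = l' \<and> m = m' then 1 else 0)"
proof -
  define S where "S = (\<Sum>k=1..N. sph_harm l m (x k) * cnj (sph_harm l' m' (x k)))"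
  from assms(1) have "N \<ge> 1" and design: "\<forall>p\<in>sph_poly t.
      1 / of_nat N * (\<Sum>i=1..N. p (x i)) = 1 / of_real (4 * pi) * (LINT y|surface_measure. p y)"
    by (auto simp: spherical_design_def)
  moreover from bspec[OF design sph_harm_mult_cnj_in_sph_poly[OF assms(2-4)]]
  have "1 / of_nat N * S = 1 / of_real (4 * pi)
      * (LINT y|surface_measure. sph_harm l m y * cnj (sph_harm l' m' y))"
    unfolding S_def .
  ultimately show ?thesis
    unfolding sph_harm_orthonormal(2)[OF assms(2,3)] S_def[symmetric] qweight_def
    by (auto simp: field_simps split: if_splits)
qed

section \<open>Framelet decomposition and reconstruction\<close>

text \<open>Both kinds of framelets are kernels of this shape. Conjugation in the second argument
  turns the coefficients into c cnj(g) and the conjugated harmonic at \<open>z\<close> into the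
  harmonic itself, so the inner product samples a polynomial at \<open>z\<close>.\<close>

lemma sph_inner_kernel:
  fixes c g :: "nat \<times> int \<Rightarrow> complex"
  assumes f: "\<And>y. y \<in> sphere 0 1 \<Longrightarrow> f y = (\<Sum>p\<in>sph_index T. c p * sph_harm (fst p) (snd p) y)"
    and c: "\<And>p. p \<notin> sph_index T \<Longrightarrow> c p = 0"
  shows "sph_inner f (\<lambda>y. of_real r * (\<Sum>p\<in>sph_index t. g p * cnj (sph_harm (fst p) (snd p) z) * sph_harm (fst p) (snd p) y))
    = of_real r * (\<Sum>p\<in>sph_index t. c p * cnj (g p) * sph_harm (fst p) (snd p) z)"
proof -
  let ?Y = "\<lambda>p. sph_harm (fst p) (snd p)"
  have Y: "integrable surface_measure (\<lambda>y. ?Y q y * cnj (?Y p y))"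
    "(LINT y|surface_measure. ?Y q y * cnj (?Y p y)) = (if q = p then 1 else 0)"
    if "q \<in> sph_index T" "p \<in> sph_index t" for p q
    using that sph_harm_orthonormal[of "snd q" "fst q" "snd p" "fst p"]
    by (auto simp: sph_index_def prod_eq_iff)
  have "sph_inner f (\<lambda>y. of_real r * (\<Sum>p\<in>sph_index t. g p * cnj (?Y p z) * ?Y p y))
      = (LINT y|surface_measure. (\<Sum>p\<in>sph_index t. \<Sum>q\<in>sph_index T.
          (of_real r * cnj (g p) * ?Y p z * c q) * (?Y q y * cnj (?Y p y))))"
    unfolding sph_inner_def
  proof (rule Bochner_Integration.integral_cong[OF refl])
    fix y
    assume "y \<in> space surface_measure"
    then have "f y = (\<Sum>q\<in>sph_index T. c q * ?Y q y)"
      using f by (simp only: space_surface_measure)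
    then show "f y * cnj (of_real r * (\<Sum>p\<in>sph_index t. g p * cnj (?Y p z) * ?Y p y))
      = (\<Sum>p\<in>sph_index t. \<Sum>q\<in>sph_index T. (of_real r * cnj (g p) * ?Y p z * c q) * (?Y q y * cnj (?Y p y)))"
      by (simp add: sum_distrib_left sum_distrib_right mult_ac)
  qed
  also have "\<dots> = (\<Sum>p\<in>sph_index t. \<Sum>q\<in>sph_index T.
      (of_real r * cnj (g p) * ?Y p z * c q) * (if q = p then 1 else 0))"
    by (simp add: Y cong: sum.cong)
  also have "\<dots> = of_real r * (\<Sum>p\<in>sph_index t. c p * cnj (g p) * ?Y p z)"
    unfolding sum_distrib_left
  proof (rule sum.cong[OF refl])
    fix p
    have "(\<Sum>q\<in>sph_index T. (of_real r * cnj (g p) * ?Y p z * c q) * (if q = p then 1 else 0))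
        = (\<Sum>q\<in>sph_index T. if q = p then of_real r * cnj (g p) * ?Y p z * c q else 0)"
      by (rule sum.cong) auto
    then show "(\<Sum>q\<in>sph_index T. (of_real r * cnj (g p) * ?Y p z * c q) * (if q = p then 1 else 0))
        = of_real r * (c p * cnj (g p) * ?Y p z)"
      \<comment> \<open>For p outside \<open>sph_index T\<close> no summand survives, which matches
        c p = 0.\<close>
      using c by (simp add: finite_sph_index mult_ac)
  qed
  finally show ?thesis .
qed

text \<open>All degrees with nonzero coefficient and the degree of \<open>p\<close> are at most t /
  2, so \<open>design_quadrature\<close> applies to every pair. One root of the weight comes from
  the samples and one from the scaling.\<close>

lemma Y_star_mult_samples:
  fixes d :: "nat \<times> int \<Rightarrow> complex"
  assumes design: "spherical_design t N x"
    and v: "\<And>k. k \<in> {1..N} \<Longrightarrow> v k = of_real (sqrt (qweight N)) * (\<Sum>q\<in>sph_index t. d q * sph_harm (fst q) (snd q) (x k))"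
    and d: "\<And>q. q \<in> sph_index t \<Longrightarrow> t < 2 * fst q \<Longrightarrow> d q = 0"
    and p: "p \<in> sph_index t" "2 * fst p \<le> t"
  shows "scale_vec (sqrt (qweight N)) (Y_star_mult N x v) p = d p"
proof -
  let ?Y = "\<lambda>p. sph_harm (fst p) (snd p)"
  have orth: "of_real (qweight N) * (\<Sum>k=1..N. ?Y q (x k) * cnj (?Y p (x k))) = (if q = p then 1 else 0)"
    if "q \<in> sph_index t" "2 * fst q \<le> t" for q
    using that p design_quadrature[OF design, of "snd q" "fst q" "snd p" "fst p"]
    by (auto simp: sph_index_def prod_eq_iff)
  have "sqrt (qweight N) * sqrt (qweight N) = qweight N"
    by (simp add: qweight_def)
  then have sqrt: "complex_of_real (sqrt (qweight N)) * of_real (sqrt (qweight N)) = of_real (qweight N)"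
    by (metis of_real_mult)
  have "scale_vec (sqrt (qweight N)) (Y_star_mult N x v) p
      = of_real (sqrt (qweight N)) * (\<Sum>k=1..N. cnj (?Y p (x k)) * v k)"
    by (simp add: scale_vec_def mat_vec_def conj_transpose_def Y_matrix_def case_prod_unfold)
  also have "\<dots> = of_real (sqrt (qweight N)) * (\<Sum>k=1..N. cnj (?Y p (x k))
      * (of_real (sqrt (qweight N)) * (\<Sum>q\<in>sph_index t. d q * ?Y q (x k))))"
    by (intro arg_cong[where f = "(*) _"] sum.cong) (simp_all add: v)
  also have "\<dots> = (\<Sum>k=1..N. \<Sum>q\<in>sph_index t.
      of_real (sqrt (qweight N)) * of_real (sqrt (qweight N)) * (d q * (?Y q (x k) * cnj (?Y p (x k)))))"
    by (simp add: sum_distrib_left mult_ac)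
  also have "\<dots> = (\<Sum>q\<in>sph_index t. d q * (of_real (qweight N) * (\<Sum>k=1..N. ?Y q (x k) * cnj (?Y p (x k)))))"
    unfolding sqrt by (subst sum.swap) (simp add: sum_distrib_left mult_ac)
  also have "\<dots> = (\<Sum>q\<in>sph_index t. if q = p then d q else 0)"
  proof (rule sum.cong[OF refl])
    fix q
    assume q: "q \<in> sph_index t"
    show "d q * (of_real (qweight N) * (\<Sum>k=1..N. ?Y q (x k) * cnj (?Y p (x k)))) = (if q = p then d q else 0)"
    proof (cases "2 * fst q \<le> t")
      case True
      then show ?thesis
        using orth[OF q] by simp
    next
      case False
      then show ?thesis
        using d[OF q] by auto
    qed
  qed
  also have "\<dots> = d p"
    using p finite_sph_index by simp
  finally show ?thesis .
qed

section \<open>Supports of the symbols and the one-level transforms\<close>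

lemma not_in_supp: "\<xi> \<notin> supp H \<Longrightarrow> H \<xi> = 0"
  using closure_subset[of "{\<xi>. H \<xi> \<noteq> 0}"] by (auto simp: supp_def)

lemma symbol_vanishes:
  assumes "supp H \<subseteq> {0..u}" "0 < t" "u * real t < real l"
  shows "H (real l / real t) = 0"
proof (rule not_in_supp)
  have "u < real l / real t"
    using assms by (simp add: less_divide_eq)
  then show "real l / real t \<notin> supp H"
    using assms(1) by auto
qed

theorem theorem4p4:
  fixes J\<^sub>0 J :: int and n :: nat
    and t N :: "int \<Rightarrow> nat" and x :: "int \<Rightarrow> nat \<Rightarrow> real^3"
    and a :: "int \<Rightarrow> complex" and b :: "nat \<Rightarrow> int \<Rightarrow> complex"
    and ah :: "real \<Rightarrow> complex" and bh :: "nat \<Rightarrow> real \<Rightarrow> complex"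
    and f :: "real^3 \<Rightarrow> complex"
    and v :: "int \<Rightarrow> nat \<Rightarrow> complex" and w :: "nat \<Rightarrow> int \<Rightarrow> nat \<Rightarrow> complex"
  assumes scales: "J\<^sub>0 \<le> J"
    and t_pos: "\<forall>j\<in>{J\<^sub>0..J+1}. 0 < t j"
    and t_double: "\<forall>j\<in>{J\<^sub>0..J}. t (j + 1) = 2 * t j"
    and design: "\<forall>j\<in>{J\<^sub>0..J+1}. spherical_design (t j) (N j) (x j)"
    and filter_a: "l1_filter a"
    and filter_b: "\<forall>s\<in>{1..n}. l1_filter (b s)"
    and unity: "\<forall>\<xi>::real. (cmod (fourier_series a \<xi>))\<^sup>2
                  + (\<Sum>s=1..n. (cmod (fourier_series (b s) \<xi>))\<^sup>2) = 1"
    and symbol_a: "is_symbol a ah" "supp ah \<subseteq> {0..1/4}"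
    and symbol_b: "\<forall>s\<in>{1..n}. is_symbol (b s) (bh s) \<and> supp (bh s) \<subseteq> {0..1/2}"
    and f_poly: "f \<in> sph_poly (t J)"
    and v_def: "\<forall>j\<in>{J\<^sub>0..J+1}. \<forall>k\<in>{1..N j}. v j k = sph_inner f (phi_framelet ah t N x J j k)"
    and w_def: "\<forall>s\<in>{1..n}. \<forall>j\<in>{J\<^sub>0..J}. \<forall>k\<in>{1..N (j+1)}.
                  w s j k = sph_inner f (psi_framelet ah (bh s) t N x J j k)"
  shows "\<forall>j\<in>{J\<^sub>0..J}.
      (let r = sqrt (qweight (N j)); r' = sqrt (qweight (N (j+1)));
           av = symbol_vec ah (t (j+1)); bv = (\<lambda>s. symbol_vec (bh s) (t (j+1)))
       in
         (\<forall>k\<in>{1..N j}.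
            v j k = scale_vec r (Y_mult (t j) (x j)
              (downsample (t j)
                (scale_vec r' (Y_star_mult (N (j+1)) (x (j+1)) (v (j+1))) \<odot>\<^sub>v conj_vec av))) k)
       \<and> (\<forall>s\<in>{1..n}. \<forall>k\<in>{1..N (j+1)}.
            w s j k = scale_vec r' (Y_mult (t (j+1)) (x (j+1))
              (scale_vec r' (Y_star_mult (N (j+1)) (x (j+1)) (v (j+1))) \<odot>\<^sub>v conj_vec (bv s))) k)
       \<and> (\<forall>k\<in>{1..N (j+1)}.
            v (j+1) k = scale_vec r' (Y_mult (t (j+1)) (x (j+1))
              (\<lambda>p. (upsample (t j) (scale_vec r (Y_star_mult (N j) (x j) (v j))) \<odot>\<^sub>v av) p
                 + (\<Sum>s=1..n. (scale_vec r' (Y_star_mult (N (j+1)) (x (j+1)) (w s j)) \<odot>\<^sub>v bv s) p))) k))"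
proof
  fix j
  assume j: "j \<in> {J\<^sub>0..J}"
  let ?Y = "\<lambda>p. sph_harm (fst p) (snd p)"
  define T T' where "T = t j" and "T' = t (j + 1)"
  define r r' where "r = sqrt (qweight (N j))" and "r' = sqrt (qweight (N (j + 1)))"
  have T': "T' = 2 * T" "0 < T'"
    using j t_double t_pos by (auto simp: T_def T'_def)
  obtain c\<^sub>0 where c\<^sub>0: "\<forall>y\<in>sphere 0 1. f y = (\<Sum>(l, m)\<in>sph_index (t J). c\<^sub>0 l m * sph_harm l m y)"
    using f_poly by (auto simp: sph_poly_def)
  \<comment> \<open>Extended by zero, since the sums over \<open>sph_index (t i)\<close> need not
    range over \<open>sph_index (t J)\<close>.\<close>
  define c where "c = (\<lambda>p. if p \<in> sph_index (t J) then c\<^sub>0 (fst p) (snd p) else 0)"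
  have f: "f y = (\<Sum>p\<in>sph_index (t J). c p * ?Y p y)" if "y \<in> sphere 0 1" for y
    unfolding c\<^sub>0[rule_format, OF that] by (rule sum.cong) (auto simp: c_def)
  have c: "c p = 0" if "p \<notin> sph_index (t J)" for p
    using that by (simp add: c_def)
  have samples: "v i k = of_real (sqrt (qweight (N i))) *
      (\<Sum>p\<in>sph_index (t i). c p * cnj (alpha ah t J i (fst p)) * ?Y p (x i k))"
    if "i \<in> {J\<^sub>0..J+1}" "k \<in> {1..N i}" for i k
    using v_def that sph_inner_kernel[OF f c, where r = "sqrt (qweight (N i))" and t = "t i"
        and g = "\<lambda>p. alpha ah t J i (fst p)" and z = "x i k"]
    by (simp add: phi_framelet_def[abs_def] case_prod_unfold)
  define A where "A p = c p * cnj (alpha ah t J (j + 1) (fst p))" for p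
  have alpha_j: "alpha ah t J j l = ah (real l / real T') * alpha ah t J (j + 1) l" for l
    using j by (subst alpha.simps) (simp add: T'_def)
  have v1: "v (j + 1) k = of_real r' * (\<Sum>p\<in>sph_index T'. A p * ?Y p (x (j + 1) k))"
    if "k \<in> {1..N (j + 1)}" for k
    using samples[of "j + 1" k] that j by (simp add: A_def r'_def T'_def)
  have v0: "v j k = of_real r * (\<Sum>p\<in>sph_index T. A p * cnj (ah (real (fst p) / real T')) * ?Y p (x j k))"
    if "k \<in> {1..N j}" for k
    using samples[of j k] that j by (simp add: A_def r_def T_def alpha_j mult_ac)
  have w1: "w s j k = of_real r' *
      (\<Sum>p\<in>sph_index T'. A p * cnj (bh s (real (fst p) / real T')) * ?Y p (x (j + 1) k))"
    if "s \<in> {1..n}" "k \<in> {1..N (j + 1)}" for s k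
    using w_def that j sph_inner_kernel[OF f c, where r = r' and t = T' and z = "x (j + 1) k"
        and g = "\<lambda>p. bh s (real (fst p) / real T') * alpha ah t J (j + 1) (fst p)"]
    by (simp add: psi_framelet_def[abs_def] beta_def case_prod_unfold A_def r'_def T'_def mult_ac)
  \<comment> \<open>At j = J this is the cutoff at t_J = T' / 2. For smaller j the symbol at scale j
    + 1 contains the factor ah(l / (2 T')), which vanishes once l / (2 T') > 1/4.\<close>
  have A_zero: "A p = 0" if "T' < 2 * fst p" for p
  proof (cases "j = J")
    case True
    then have "alpha ah t J (j + 1) (fst p) = 0"
      using that T' by (subst alpha.simps) (simp add: T_def)
    then show ?thesis
      by (simp add: A_def)
  next
    case False
    then have "t (j + 2) = 2 * T'" and j': "j + 1 \<le> J"
      using j t_double[rule_format, of "j + 1"] by (auto simp: T'_def add.commute)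
    moreover from this have "ah (real (fst p) / real (t (j + 2))) = 0"
      using T'(2) that by (intro symbol_vanishes[OF symbol_a(2)]) auto
    ultimately have "alpha ah t J (j + 1) (fst p) = 0"
      by (subst alpha.simps) (simp add: add.assoc)
    then show ?thesis
      by (simp add: A_def)
  qed
  \<comment> \<open>As T' = 2 T, the support bounds 1/4 and 1/2 become the degrees T / 2 and T' / 2,
    half the degree of the design at which the samples are taken.\<close>
  have ah_zero: "ah (real l / real T') = 0" if "T < 2 * l" for l
    using T' that by (intro symbol_vanishes[OF symbol_a(2)]) auto
  have bh_zero: "bh s (real l / real T') = 0" if "T < l" "s \<in> {1..n}" for s l
    using T' that symbol_b by (intro symbol_vanishes[where u = "1/2"]) auto
  have half: "p \<in> sph_index T" if "p \<in> sph_index T'" "fst p \<le> T" for p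
    using that by (auto simp: sph_index_def)
  have design': "spherical_design T (N j) (x j)" "spherical_design T' (N (j + 1)) (x (j + 1))"
    using design j by (auto simp: T_def T'_def)
  \<comment> \<open>Above degree T the adjoint may return aliased values. Downsampling discards
    them, or a vanishing symbol multiplies them.\<close>
  have coeff_v1: "scale_vec r' (Y_star_mult (N (j + 1)) (x (j + 1)) (v (j + 1))) p = A p"
    if "p \<in> sph_index T'" "fst p \<le> T" for p
    using that v1 A_zero T' unfolding r'_def by (intro Y_star_mult_samples[OF design'(2)]) auto
  have coeff_w: "scale_vec r' (Y_star_mult (N (j + 1)) (x (j + 1)) (w s j)) p
      = A p * cnj (bh s (real (fst p) / real T'))"
    if "p \<in> sph_index T'" "fst p \<le> T" "s \<in> {1..n}" for p s
    using that w1[of s] A_zero T' unfolding r'_def by (intro Y_star_mult_samples[OF design'(2)]) auto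
  have coeff_v0: "scale_vec r (Y_star_mult (N j) (x j) (v j)) p = A p * cnj (ah (real (fst p) / real T'))"
    if "p \<in> sph_index T" "2 * fst p \<le> T" for p
    using that v0 ah_zero unfolding r_def by (intro Y_star_mult_samples[OF design'(1)]) auto
  \<comment> \<open>The partition of unity concerns the Fourier series; l \<le> T places l / T' in
    [0, 1/2], where the symbols agree with them.\<close>
  have pou: "ah (real l / real T') * cnj (ah (real l / real T'))
      + (\<Sum>s=1..n. bh s (real l / real T') * cnj (bh s (real l / real T'))) = 1" if "l \<le> T" for l
  proof -
    let ?\<xi> = "real l / real T'"
    have \<xi>: "?\<xi> \<in> {0..1/2}"
      using that T' by (simp add: divide_simps)
    have "ah ?\<xi> = fourier_series a ?\<xi>"
      using \<xi> symbol_a(1) by (simp only: is_symbol_def)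
    moreover have "(\<Sum>s=1..n. bh s ?\<xi> * cnj (bh s ?\<xi>)) = (\<Sum>s=1..n. of_real ((cmod (fourier_series (b s) ?\<xi>))\<^sup>2))"
    proof (rule sum.cong[OF refl])
      fix s
      assume "s \<in> {1..n}"
      then have "bh s ?\<xi> = fourier_series (b s) ?\<xi>"
        using \<xi> symbol_b by (simp only: is_symbol_def)
      then show "bh s ?\<xi> * cnj (bh s ?\<xi>) = of_real ((cmod (fourier_series (b s) ?\<xi>))\<^sup>2)"
        by (simp only: complex_norm_square)
    qed
    ultimately have "ah ?\<xi> * cnj (ah ?\<xi>) + (\<Sum>s=1..n. bh s ?\<xi> * cnj (bh s ?\<xi>))
        = of_real ((cmod (fourier_series a ?\<xi>))\<^sup>2 + (\<Sum>s=1..n. (cmod (fourier_series (b s) ?\<xi>))\<^sup>2))"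
      by (simp only: complex_norm_square of_real_add of_real_sum)
    then show ?thesis
      by (simp only: unity[rule_format] of_real_1)
  qed
  have mult_eq: "scale_vec q (Y_mult u z d) k = of_real q * (\<Sum>p\<in>sph_index u. d p * ?Y p (z k))"
    for q u z d k
    by (simp add: scale_vec_def mat_vec_def Y_matrix_def case_prod_unfold mult.commute)
  show "let r = sqrt (qweight (N j)); r' = sqrt (qweight (N (j+1)));
           av = symbol_vec ah (t (j+1)); bv = (\<lambda>s. symbol_vec (bh s) (t (j+1)))
       in
         (\<forall>k\<in>{1..N j}.
            v j k = scale_vec r (Y_mult (t j) (x j)
              (downsample (t j)
                (scale_vec r' (Y_star_mult (N (j+1)) (x (j+1)) (v (j+1))) \<odot>\<^sub>v conj_vec av))) k)
       \<and> (\<forall>s\<in>{1..n}. \<forall>k\<in>{1..N (j+1)}.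
            w s j k = scale_vec r' (Y_mult (t (j+1)) (x (j+1))
              (scale_vec r' (Y_star_mult (N (j+1)) (x (j+1)) (v (j+1))) \<odot>\<^sub>v conj_vec (bv s))) k)
       \<and> (\<forall>k\<in>{1..N (j+1)}.
            v (j+1) k = scale_vec r' (Y_mult (t (j+1)) (x (j+1))
              (\<lambda>p. (upsample (t j) (scale_vec r (Y_star_mult (N j) (x j) (v j))) \<odot>\<^sub>v av) p
                 + (\<Sum>s=1..n. (scale_vec r' (Y_star_mult (N (j+1)) (x (j+1)) (w s j)) \<odot>\<^sub>v bv s) p))) k)"
    unfolding Let_def T_def[symmetric] T'_def[symmetric] r_def[symmetric] r'_def[symmetric] mult_eq
  proof (intro conjI ballI)
    fix k
    assume k: "k \<in> {1..N j}"
    show "v j k = of_real r * (\<Sum>p\<in>sph_index T. downsample T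
        (scale_vec r' (Y_star_mult (N (j+1)) (x (j+1)) (v (j+1))) \<odot>\<^sub>v conj_vec (symbol_vec ah T')) p * ?Y p (x j k))"
      unfolding v0[OF k]
    proof (intro arg_cong[where f = "(*) (of_real r)"] sum.cong refl)
      fix p
      assume p: "p \<in> sph_index T"
      then have "p \<in> sph_index T'" "fst p \<le> T"
        using T' by (auto simp: sph_index_def)
      then show "A p * cnj (ah (real (fst p) / real T')) * ?Y p (x j k) = downsample T
        (scale_vec r' (Y_star_mult (N (j+1)) (x (j+1)) (v (j+1))) \<odot>\<^sub>v conj_vec (symbol_vec ah T')) p * ?Y p (x j k)"
        using p coeff_v1[of p]
        by (simp add: downsample_def hadamard_def conj_vec_def symbol_vec_def case_prod_unfold)
    qed
  next
    fix s k
    assume s: "s \<in> {1..n}" and k: "k \<in> {1..N (j + 1)}"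
    show "w s j k = of_real r' * (\<Sum>p\<in>sph_index T'.
        (scale_vec r' (Y_star_mult (N (j+1)) (x (j+1)) (v (j+1))) \<odot>\<^sub>v conj_vec (symbol_vec (bh s) T')) p
          * ?Y p (x (j+1) k))"
      unfolding w1[OF s k]
    proof (intro arg_cong[where f = "(*) (of_real r')"] sum.cong refl)
      fix p
      assume p: "p \<in> sph_index T'"
      show "A p * cnj (bh s (real (fst p) / real T')) * ?Y p (x (j+1) k) =
        (scale_vec r' (Y_star_mult (N (j+1)) (x (j+1)) (v (j+1))) \<odot>\<^sub>v conj_vec (symbol_vec (bh s) T')) p
          * ?Y p (x (j+1) k)"
        using bh_zero[OF _ s, of "fst p"] coeff_v1[OF p]
        by (cases "fst p \<le> T") (simp_all add: hadamard_def conj_vec_def symbol_vec_def case_prod_unfold)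
    qed
  next
    fix k
    assume k: "k \<in> {1..N (j + 1)}"
    show "v (j + 1) k = of_real r' * (\<Sum>p\<in>sph_index T'.
        ((upsample T (scale_vec r (Y_star_mult (N j) (x j) (v j))) \<odot>\<^sub>v symbol_vec ah T') p
          + (\<Sum>s=1..n. (scale_vec r' (Y_star_mult (N (j+1)) (x (j+1)) (w s j)) \<odot>\<^sub>v symbol_vec (bh s) T') p))
          * ?Y p (x (j+1) k))"
      unfolding v1[OF k]
    proof (intro arg_cong[where f = "(*) (of_real r')"] sum.cong refl arg_cong2[where f = "(*)"])
      fix p
      assume p: "p \<in> sph_index T'"
      let ?\<xi> = "real (fst p) / real T'"
      have up: "(upsample T (scale_vec r (Y_star_mult (N j) (x j) (v j))) \<odot>\<^sub>v symbol_vec ah T') p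
          = A p * (ah ?\<xi> * cnj (ah ?\<xi>))"
        using ah_zero[of "fst p"] coeff_v0[of p] half[OF p]
        by (cases "2 * fst p \<le> T") (simp_all add: hadamard_def upsample_def symbol_vec_def case_prod_unfold mult_ac)
      have detail: "(scale_vec r' (Y_star_mult (N (j+1)) (x (j+1)) (w s j)) \<odot>\<^sub>v symbol_vec (bh s) T') p
          = A p * (bh s ?\<xi> * cnj (bh s ?\<xi>))" if "s \<in> {1..n}" for s
        using bh_zero[OF _ that, of "fst p"] coeff_w[OF p _ that]
        by (cases "fst p \<le> T") (simp_all add: hadamard_def symbol_vec_def case_prod_unfold mult_ac)
      \<comment> \<open>Above degree T, outside the reach of \<open>pou\<close>, both sides are zero
        because A p = 0.\<close>
      have "A p = A p * (ah ?\<xi> * cnj (ah ?\<xi>) + (\<Sum>s=1..n. bh s ?\<xi> * cnj (bh s ?\<xi>)))"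
        using pou[of "fst p"] A_zero[of p] T'(1) by (cases "fst p \<le> T") auto
      also have "\<dots> = A p * (ah ?\<xi> * cnj (ah ?\<xi>)) + (\<Sum>s=1..n. A p * (bh s ?\<xi> * cnj (bh s ?\<xi>)))"
        by (simp only: distrib_left sum_distrib_left)
      finally show "A p = (upsample T (scale_vec r (Y_star_mult (N j) (x j) (v j))) \<odot>\<^sub>v symbol_vec ah T') p
          + (\<Sum>s=1..n. (scale_vec r' (Y_star_mult (N (j+1)) (x (j+1)) (w s j)) \<odot>\<^sub>v symbol_vec (bh s) T') p)"
        using detail by (simp only: up cong: sum.cong)
    qed
  qed
qed

end
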